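(* Let $D=(V,A)$ be a finite oriented graph with $m=|A|\ge 1$, and let $W\colon[0,1]^2\to[0,1]$ be a directed kernel. Suppose that for every arc $a\in A$ the arc-rooted density $r_a^W$ is almost everywhere equal to a constant, and that $t(D,W)>0$. (i) If $D$ is not Eulerian, then $W=p$ almost everywhere, where $p:=t(D,W)^{1/m}$. (ii) If $D$ is Eulerian, then $$W(x,y)=p\exp(\phi(x)-\phi(y))\quad\text{for almost every }(x,y)\in[0,1]^2,$$ where $p:=t(D,W)^{1/m}\in(0,1]$ and $\phi\colon[0,1]\to\mathbb{R}$ is some bounded measurable function. Conversely, for every kernel of the form $W(x,y)=p\exp(\phi(x)-\phi(y))$ (with $p\in(0,1]$ and $\phi$ bounded measurable) satisfying $0\le W\le 1$, and for every Eulerian finite oriented graph $D$ with $m\ge1$ arcs, every arc-rooted density $r_a^W$ of $D$ is equal to $p^m$ almost everywhere.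
   Context: A finite oriented graph $D=(V,A)$ is a finite directed graph with no loops, no repeated arcs and no pairs of opposite arcs. $D$ is Eulerian if every non-isolated vertex has equal indegree and outdegree (no connectivity is required). A directed kernel is an arbitrary measurable function $W\colon[0,1]^2\to[0,1]$ (not assumed symmetric). Integrals are with respect to Lebesgue measure. Define $$t(D,W):=\int_{[0,1]^V}\prod_{(s,t)\in A}W(x_s,x_t)\prod_{v\in V}dx_v.$$ For an arc $a=(i,j)\in A$, the arc-rooted density $r_a^W(x,y)$ is the function on $[0,1]^2$ obtained from the same integrand by fixing $x_i=x$, $x_j=y$ and integrating the remaining vertex variables over $[0,1]^{V\setminus\{i,j\}}$ (the factor of $a$ itself is included). *)

theory Defs
  imports "HOL-Analysis.Analysis" "Graph_Theory.Digraph"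
begin

text \<open>Finite, loops and repeated arcs excluded: this is the locale \<^locale>\<open>digraph\<close>.\<close>

locale oriented_graph = digraph +
  assumes no_opposite_arcs: "(u, v) \<in> arcs_ends G \<Longrightarrow> (v, u) \<notin> arcs_ends G"

definition isolated_vertex :: "('v, 'e) pre_digraph \<Rightarrow> 'v \<Rightarrow> bool" where
  "isolated_vertex D v \<longleftrightarrow> in_arcs D v = {} \<and> out_arcs D v = {}"

definition eulerian :: "('v, 'e) pre_digraph \<Rightarrow> bool" where
  "eulerian D \<longleftrightarrow> (\<forall>v\<in>verts D. \<not> isolated_vertex D v \<longrightarrow> in_degree D v = out_degree D v)"

text \<open>Measurability is Lebesgue measurability throughout. Only the values on the unit square
  (for kernels) and on the unit interval (for functions of one variable) matter.\<close>

abbreviation unit_square_measure :: "(real \<times> real) measure" where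
  "unit_square_measure \<equiv> lebesgue_on ({0..1} \<times> {0..1})"

definition directed_kernel :: "(real \<Rightarrow> real \<Rightarrow> real) \<Rightarrow> bool" where
  "directed_kernel W \<longleftrightarrow>
     (\<lambda>(x, y). W x y) \<in> borel_measurable unit_square_measure \<and>
     (\<forall>x\<in>{0..1}. \<forall>y\<in>{0..1}. W x y \<in> {0..1})"

text \<open>Lebesgue measure on the cube with coordinates indexed by \<open>I\<close>. The completion is needed:
  for a Lebesgue measurable kernel, the integrands below need not be measurable with respect
  to the plain product sigma-algebra, and the integral of a non-measurable function is 0
  by convention.\<close>

definition unit_cube_measure :: "'v set \<Rightarrow> ('v \<Rightarrow> real) measure" where
  "unit_cube_measure I = completion (\<Pi>\<^sub>M v\<in>I. lebesgue_on {0..1})"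

definition arc_product :: "('v, 'e) pre_digraph \<Rightarrow> (real \<Rightarrow> real \<Rightarrow> real) \<Rightarrow> ('v \<Rightarrow> real) \<Rightarrow> real" where
  "arc_product D W z = (\<Prod>e\<in>arcs D. W (z (tail D e)) (z (head D e)))"

definition hom_density :: "('v, 'e) pre_digraph \<Rightarrow> (real \<Rightarrow> real \<Rightarrow> real) \<Rightarrow> real" where
  "hom_density D W = (LINT z|unit_cube_measure (verts D). arc_product D W z)"

definition arc_rooted_density ::
    "('v, 'e) pre_digraph \<Rightarrow> (real \<Rightarrow> real \<Rightarrow> real) \<Rightarrow> 'e \<Rightarrow> real \<Rightarrow> real \<Rightarrow> real" where
  "arc_rooted_density D W a x y =
     (LINT z|unit_cube_measure (verts D - {tail D a, head D a}).
        arc_product D W (z(tail D a := x, head D a := y)))"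

definition bounded_measurable :: "(real \<Rightarrow> real) \<Rightarrow> bool" where
  "bounded_measurable \<phi> \<longleftrightarrow>
     \<phi> \<in> borel_measurable (lebesgue_on {0..1}) \<and> bounded (\<phi> ` {0..1})"

end

theory Submission
  imports Defs "HOL-Probability.Probability"
begin

text \<open>
  Let \<open>h(z)\<close> be the product of \<open>W\<close> over the arcs, \<open>t > 0\<close> its integral and \<open>m\<close> the number of arcs.
  Integrating over the two free variables, the constant value of every arc-rooted density must
  be \<open>t\<close>. Since \<open>W \<le> 1\<close>, a rooted density is at most \<open>W\<close>, so \<open>W \<ge> t\<close> almost everywhere and \<open>ln W\<close> is
  bounded.

  The key step is an entropy argument. The hypothesis says that the probability density \<open>h / t\<close>
  has uniform marginals on every arc. As \<open>ln h\<close> is a sum of functions of single arcs, its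
  integrals against \<open>h / t\<close> and against the uniform density coincide, so
  \<open>\<integral> (h - t) (ln h - ln t) = 0\<close>. The integrand is nonnegative and vanishes only where \<open>h = t\<close>;
  hence \<open>h = t\<close> almost everywhere (\<open>AE_arc_sum_log_kernel\<close>).

  It remains to solve the functional equation that the sum of \<open>f = ln W\<close> over the arcs is the
  constant \<open>ln t\<close> (\<open>AE_arc_sum_const_imp_potential\<close>). Freezing all vertices except the two ends of
  one arc, no other arc sees both ends, so \<open>f(x, y) = \<alpha>(x) + \<beta>(y)\<close>. The equation then separates
  into one equation per vertex: \<open>d\<^sup>+(v) \<alpha> + d\<^sup>-(v) \<beta>\<close> is constant. Summing over \<open>v\<close> gives
  \<open>\<alpha> + \<beta> = ln t / m\<close>, so that \<open>f(x, y) = ln t / m + \<alpha>(x) - \<alpha>(y)\<close>, and a vertex with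
  \<open>d\<^sup>+(v) \<noteq> d\<^sup>-(v)\<close> forces \<open>\<alpha>\<close> to be constant.

  Conversely, around an Eulerian graph the potential differences cancel, so that \<open>h\<close> is
  identically \<open>p ^ m\<close> and so are its partial integrals.

  The argument is carried out for an arbitrary probability measure on the reals in place of
  Lebesgue measure. The passage from Lebesgue measurable kernels and completed measures to this
  setting replaces the kernel by a Borel function that agrees with it almost everywhere.
\<close>

section \<open>Almost everywhere statements and coordinates of product measures\<close>

lemma AE_measure_preserving:
  assumes "f \<in> M \<rightarrow>\<^sub>M N" "distr M N f = N" "AE x in N. P x"
  shows "AE x in M. P (f x)"
proof (rule AE_distrD[OF assms(1)])
  show "AE x in distr M N f. P x" using assms(2,3) by metis
qed

lemma (in prob_space) distr_update_PiM:
  assumes "v \<in> V"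
  shows "distr (M \<Otimes>\<^sub>M PiM (V - {v}) (\<lambda>_. M)) (PiM V (\<lambda>_. M)) (\<lambda>(x, z). z(v := x)) = PiM V (\<lambda>_. M)"
  using distr_pair_PiM_eq_PiM[of "V - {v}" "\<lambda>_. M" v] assms
  by (simp add: insert_absorb prob_space_axioms)

lemma measurable_update2_PiM:
  assumes "i \<in> V" "j \<in> V"
  shows "(\<lambda>((x, y), z). z(i := x, j := y)) \<in>
    ((M \<Otimes>\<^sub>M M) \<Otimes>\<^sub>M PiM (V - {i, j}) (\<lambda>_. M)) \<rightarrow>\<^sub>M PiM V (\<lambda>_. M)"
proof -
  have "(\<lambda>p. (snd p)(i := fst (fst p))) \<in>
      ((M \<Otimes>\<^sub>M M) \<Otimes>\<^sub>M PiM (V - {i, j}) (\<lambda>_. M)) \<rightarrow>\<^sub>M PiM (insert i (V - {i, j})) (\<lambda>_. M)"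
    by (rule measurable_fun_upd[where J="V - {i, j}"]) auto
  then have "(\<lambda>p. (snd p)(i := fst (fst p), j := snd (fst p))) \<in>
      ((M \<Otimes>\<^sub>M M) \<Otimes>\<^sub>M PiM (V - {i, j}) (\<lambda>_. M)) \<rightarrow>\<^sub>M PiM V (\<lambda>_. M)"
    by (rule measurable_fun_upd[rotated]) (use assms in auto)
  then show ?thesis by (simp add: split_beta')
qed

text \<open>Fubini for the two ends of an arc: drawing the coordinates \<open>i\<close> and \<open>j\<close> first and the
  remaining ones afterwards, all independently, gives a point of the full product.\<close>

lemma (in prob_space) distr_update2_PiM:
  assumes fin: "finite V" and ij: "i \<in> V" "j \<in> V" "i \<noteq> j"
  shows "distr ((M \<Otimes>\<^sub>M M) \<Otimes>\<^sub>M PiM (V - {i, j}) (\<lambda>_. M)) (PiM V (\<lambda>_. M))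
    (\<lambda>((x, y), z). z(i := x, j := y)) = PiM V (\<lambda>_. M)" (is "distr ?N ?P ?T = ?P")
proof -
  interpret P: product_prob_space "\<lambda>_. M" by unfold_locales
  interpret R: prob_space "PiM (V - {i, j}) (\<lambda>_. M)" by (rule prob_space_PiM) (rule prob_space_axioms)
  interpret MM: pair_prob_space M M ..
  note [measurable] = measurable_update2_PiM[OF ij(1,2)]
  show ?thesis
  proof (rule P.PiM_eqI[OF fin])
    fix A assume A: "\<And>k. k \<in> V \<Longrightarrow> A k \<in> sets M"
    have AsM: "A k \<subseteq> space M" if "k \<in> V" for k using A[OF that] by (rule sets.sets_into_space)
    have "?T -` (Pi\<^sub>E V A) \<inter> space ?N = (A i \<times> A j) \<times> Pi\<^sub>E (V - {i, j}) A"
    proof (intro set_eqI iffI; clarsimp simp: space_pair_measure space_PiM)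
      fix x y z assume z: "z(i := x, j := y) \<in> Pi\<^sub>E V A" "z \<in> (V - {i, j}) \<rightarrow>\<^sub>E space M"
      have *: "k \<in> V \<Longrightarrow> (z(i := x, j := y)) k \<in> A k" for k using z(1) by (auto simp: PiE_iff)
      have "x \<in> A i" "y \<in> A j" using *[of i] *[of j] ij by auto
      moreover have "z \<in> Pi\<^sub>E (V - {i, j}) A"
      proof (rule PiE_I)
        show "z k \<in> A k" if "k \<in> V - {i, j}" for k using *[of k] that by auto
        show "z k = undefined" if "k \<notin> V - {i, j}" for k using z(2) that by (rule PiE_arb)
      qed
      ultimately show "x \<in> A i \<and> y \<in> A j \<and> z \<in> Pi\<^sub>E (V - {i, j}) A" by blast
    next
      fix x y z assume z: "x \<in> A i" "y \<in> A j" "z \<in> Pi\<^sub>E (V - {i, j}) A"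
      have "z(i := x, j := y) \<in> Pi\<^sub>E V A"
      proof (rule PiE_I)
        show "(z(i := x, j := y)) k \<in> A k" if "k \<in> V" for k
          using that z(1,2) PiE_mem[OF z(3), of k] by auto
        show "(z(i := x, j := y)) k = undefined" if "k \<notin> V" for k
          using that ij PiE_arb[OF z(3), of k] by auto
      qed
      moreover have "z \<in> (V - {i, j}) \<rightarrow>\<^sub>E space M"
        using z(3) PiE_mono[of "V - {i, j}" A "\<lambda>_. space M"] AsM by blast
      ultimately show "z(i := x, j := y) \<in> Pi\<^sub>E V A \<and> x \<in> space M \<and> y \<in> space M \<and> z \<in> (V - {i, j}) \<rightarrow>\<^sub>E space M"
        using z(1,2) AsM ij by blast
    qed
    then have "emeasure (distr ?N ?P ?T) (Pi\<^sub>E V A) = emeasure ?N ((A i \<times> A j) \<times> Pi\<^sub>E (V - {i, j}) A)"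
      using A fin by (subst emeasure_distr) (auto intro!: sets_PiM_I_finite)
    also have "\<dots> = emeasure (M \<Otimes>\<^sub>M M) (A i \<times> A j) * emeasure (PiM (V - {i, j}) (\<lambda>_. M)) (Pi\<^sub>E (V - {i, j}) A)"
      using A fin ij by (intro R.emeasure_pair_measure_Times) (auto intro!: sets_PiM_I_finite)
    also have "emeasure (M \<Otimes>\<^sub>M M) (A i \<times> A j) = emeasure M (A i) * emeasure M (A j)"
      using A ij by (intro emeasure_pair_measure_Times) auto
    also have "emeasure (PiM (V - {i, j}) (\<lambda>_. M)) (Pi\<^sub>E (V - {i, j}) A) = (\<Prod>k\<in>V - {i} - {j}. emeasure M (A k))"
      using A fin unfolding Diff_insert2[of V i "{j}"] by (intro P.emeasure_PiM) auto
    also have "emeasure M (A i) * emeasure M (A j) * (\<Prod>k\<in>V - {i} - {j}. emeasure M (A k))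
        = emeasure M (A i) * (\<Prod>k\<in>V - {i}. emeasure M (A k))"
      using prod.remove[of "V - {i}" j "\<lambda>k. emeasure M (A k)"] fin ij by (simp only: mult.assoc) auto
    also have "\<dots> = (\<Prod>k\<in>V. emeasure M (A k))"
      using prod.remove[of V i "\<lambda>k. emeasure M (A k)"] fin ij by simp
    finally show "emeasure (distr ?N ?P ?T) (Pi\<^sub>E V A) = (\<Prod>k\<in>V. emeasure M (A k))" .
  qed simp
qed

lemma (in prob_space) distr_pair_components_PiM:
  assumes fin: "finite V" and ij: "i \<in> V" "j \<in> V" "i \<noteq> j"
  shows "distr (PiM V (\<lambda>_. M)) (M \<Otimes>\<^sub>M M) (\<lambda>z. (z i, z j)) = M \<Otimes>\<^sub>M M"
proof -
  interpret R: prob_space "PiM (V - {i, j}) (\<lambda>_. M)" by (rule prob_space_PiM) (rule prob_space_axioms)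
  interpret MM: pair_prob_space M M ..
  note [measurable] = measurable_update2_PiM[OF ij(1,2)]
  have [measurable]: "(\<lambda>z. (z i, z j)) \<in> PiM V (\<lambda>_. M) \<rightarrow>\<^sub>M M \<Otimes>\<^sub>M M"
    using ij by measurable
  have "distr (PiM V (\<lambda>_. M)) (M \<Otimes>\<^sub>M M) (\<lambda>z. (z i, z j)) =
     distr ((M \<Otimes>\<^sub>M M) \<Otimes>\<^sub>M PiM (V - {i, j}) (\<lambda>_. M)) (M \<Otimes>\<^sub>M M) fst"
    using ij
    by (subst distr_update2_PiM[OF fin ij, symmetric], subst distr_distr)
      (auto intro!: distr_cong simp: o_def)
  also have "\<dots> = M \<Otimes>\<^sub>M M" by (rule R.distr_pair_fst)
  finally show ?thesis .
qed

lemma (in prob_space) AE_imp_ex_in_space: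
  assumes "AE x in M. P x"
  shows "\<exists>x\<in>space M. P x"
proof -
  have "AE x in M. x \<in> space M \<and> P x" using assms AE_space by eventually_elim auto
  moreover have "ae_filter M \<noteq> bot" by (simp add: ae_filter_eq_bot_iff emeasure_space_1)
  ultimately show ?thesis using eventually_happens by blast
qed

lemma (in prob_space) AE_pair_fstI:
  assumes "AE x in M. P x" shows "AE p in M \<Otimes>\<^sub>M M. P (fst p)"
  by (rule AE_measure_preserving[OF measurable_fst distr_pair_fst assms])

lemma (in prob_space) AE_pair_sndI:
  assumes "AE x in M. P x" shows "AE p in M \<Otimes>\<^sub>M M. P (snd p)"
proof -
  interpret MM: pair_prob_space M M ..
  have "distr (M \<Otimes>\<^sub>M M) M snd = distr (distr (M \<Otimes>\<^sub>M M) (M \<Otimes>\<^sub>M M) (\<lambda>(x, y). (y, x))) M fst"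
    by (subst distr_distr) (auto simp: o_def split_beta)
  also have "\<dots> = M" unfolding MM.distr_pair_swap[symmetric] by (rule distr_pair_fst)
  finally show ?thesis by (rule AE_measure_preserving[OF measurable_snd _ assms])
qed

section \<open>Functions of arcs with constant sum\<close>

lemma (in fin_digraph) sum_tail_eq_sum_out_degree:
  fixes \<phi> :: "'a \<Rightarrow> real"
  shows "(\<Sum>e\<in>arcs G. \<phi> (tail G e)) = (\<Sum>v\<in>verts G. real (out_degree G v) * \<phi> v)"
proof -
  have "(\<Sum>e\<in>arcs G. \<phi> (tail G e)) = (\<Sum>v\<in>verts G. \<Sum>e\<in>{e \<in> arcs G. tail G e = v}. \<phi> (tail G e))"
    by (rule sum.group[symmetric]) auto
  then show ?thesis by (simp add: out_degree_def out_arcs_def)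
qed

lemma (in fin_digraph) sum_head_eq_sum_in_degree:
  fixes \<phi> :: "'a \<Rightarrow> real"
  shows "(\<Sum>e\<in>arcs G. \<phi> (head G e)) = (\<Sum>v\<in>verts G. real (in_degree G v) * \<phi> v)"
proof -
  have "(\<Sum>e\<in>arcs G. \<phi> (head G e)) = (\<Sum>v\<in>verts G. \<Sum>e\<in>{e \<in> arcs G. head G e = v}. \<phi> (head G e))"
    by (rule sum.group[symmetric]) auto
  then show ?thesis by (simp add: in_degree_def in_arcs_def)
qed

text \<open>By Fubini all coordinates except \<open>v\<close> can be frozen at one typical point; the sum then leaves
  \<open>g v\<close> plus a constant.\<close>

lemma (in prob_space) AE_sum_components_const_imp_AE_const:
  fixes g :: "'v \<Rightarrow> 'a \<Rightarrow> real"
  assumes fin: "finite V" and g[measurable]: "\<And>v. v \<in> V \<Longrightarrow> g v \<in> borel_measurable M"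
    and AE: "AE z in PiM V (\<lambda>_. M). (\<Sum>v\<in>V. g v (z v)) = \<kappa>" and v: "v \<in> V"
  shows "\<exists>c. AE x in M. g v x = c"
proof -
  let ?R = "PiM (V - {v}) (\<lambda>_. M)" and ?T = "\<lambda>(x, z). z(v := x)"
  interpret R: prob_space ?R by (rule prob_space_PiM) (rule prob_space_axioms)
  interpret MR: pair_prob_space M ?R ..
  have T: "?T \<in> M \<Otimes>\<^sub>M ?R \<rightarrow>\<^sub>M PiM V (\<lambda>_. M)"
    unfolding split_beta' by (rule measurable_fun_upd[where J="V - {v}"]) (use v in auto)
  have S: "(\<lambda>z. \<Sum>v\<in>V. g v (z v)) \<in> borel_measurable (PiM V (\<lambda>_. M))"
    using g by measurable
  have "AE p in M \<Otimes>\<^sub>M ?R. (\<Sum>u\<in>V. g u (?T p u)) = \<kappa>"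
    by (rule AE_measure_preserving[OF T distr_update_PiM[OF v] AE])
  from MR.AE_pair[OF this] have "AE x in M. AE z in ?R. (\<Sum>u\<in>V. g u (?T (x, z) u)) = \<kappa>" .
  then have "AE z in ?R. AE x in M. (\<Sum>u\<in>V. g u (?T (x, z) u)) = \<kappa>"
    by (subst MR.AE_commute[symmetric]) (use measurable_compose[OF T S] in \<open>auto simp: split_beta'\<close>)
  then obtain z where "AE x in M. (\<Sum>u\<in>V. g u (?T (x, z) u)) = \<kappa>"
    using R.AE_imp_ex_in_space by blast
  moreover have "(\<Sum>u\<in>V. g u (?T (x, z) u)) = g v x + (\<Sum>u\<in>V - {v}. g u (z u))" for x
    by (subst sum.remove[OF fin v]) simp
  ultimately have "AE x in M. g v x = \<kappa> - (\<Sum>u\<in>V - {v}. g u (z u))"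
    by (auto elim!: eventually_mono)
  then show ?thesis ..
qed

text \<open>Freeze all coordinates other than the two ends of the arc \<open>a\<close> at a typical point. Since there
  are neither parallel nor opposite arcs, every other arc touches at most one end of \<open>a\<close>, so the
  remaining terms split into a function of the tail coordinate and a function of the head
  coordinate.\<close>

lemma (in prob_space) AE_arc_sum_const_imp_separable:
  fixes f :: "'a \<times> 'a \<Rightarrow> real" and D :: "('v, 'e) pre_digraph"
  assumes "oriented_graph D" and a: "a \<in> arcs D"
    and f[measurable]: "f \<in> borel_measurable (M \<Otimes>\<^sub>M M)" and bnd: "\<And>p. \<bar>f p\<bar> \<le> C"
    and AE: "AE z in PiM (verts D) (\<lambda>_. M). (\<Sum>e\<in>arcs D. f (z (tail D e), z (head D e))) = \<kappa>"
  obtains \<alpha> \<beta> B where "\<alpha> \<in> borel_measurable M" "\<beta> \<in> borel_measurable M" "\<And>x. \<bar>\<alpha> x\<bar> \<le> B"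
    "AE p in M \<Otimes>\<^sub>M M. f p = \<alpha> (fst p) + \<beta> (snd p)"
proof -
  interpret D: oriented_graph D by fact
  define i j where "i = tail D a" and "j = head D a"
  have ij: "i \<in> verts D" "j \<in> verts D" "i \<noteq> j"
    using a D.no_loops unfolding i_def j_def by auto
  have other: "\<not> (i \<in> {tail D e, head D e} \<and> j \<in> {tail D e, head D e})"
    if "e \<in> arcs D" "e \<noteq> a" for e
  proof
    assume "i \<in> {tail D e, head D e} \<and> j \<in> {tail D e, head D e}"
    then consider "tail D e = i" "head D e = j" | "tail D e = j" "head D e = i"
      using ij by auto
    then show False
    proof cases
      case 1
      then show False using D.no_multi_arcs[of e a] that a by (auto simp: arc_to_ends_def i_def j_def)
    next
      case 2
      then have "(j, i) \<in> arcs_ends D" "(i, j) \<in> arcs_ends D"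
        using that(1) a by (auto simp: arcs_ends_def arc_to_ends_def i_def j_def image_iff intro!: bexI)
      then show False using D.no_opposite_arcs by blast
    qed
  qed
  let ?V = "verts D" and ?R = "PiM (verts D - {i, j}) (\<lambda>_. M)"
  let ?T = "\<lambda>((x, y), z). z(i := x, j := y)"
  let ?S = "\<lambda>z. \<Sum>e\<in>arcs D. f (z (tail D e), z (head D e))"
  interpret R: prob_space ?R by (rule prob_space_PiM) (rule prob_space_axioms)
  interpret MM: pair_prob_space M M ..
  interpret MR: pair_prob_space "M \<Otimes>\<^sub>M M" ?R ..
  have T: "?T \<in> (M \<Otimes>\<^sub>M M) \<Otimes>\<^sub>M ?R \<rightarrow>\<^sub>M PiM ?V (\<lambda>_. M)"
    by (rule measurable_update2_PiM[OF ij(1,2)])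
  have S: "?S \<in> borel_measurable (PiM ?V (\<lambda>_. M))"
    by (intro borel_measurable_sum measurable_compose[OF _ f] measurable_Pair measurable_component_singleton) auto
  have "AE q in (M \<Otimes>\<^sub>M M) \<Otimes>\<^sub>M ?R. ?S (?T q) = \<kappa>"
    by (rule AE_measure_preserving[OF T distr_update2_PiM[OF D.finite_verts ij] AE])
  from MR.AE_pair[OF this] have "AE p in M \<Otimes>\<^sub>M M. AE z in ?R. ?S (?T (p, z)) = \<kappa>" .
  then have "AE z in ?R. AE p in M \<Otimes>\<^sub>M M. ?S (?T (p, z)) = \<kappa>"
    by (subst MR.AE_commute[symmetric]) (use measurable_compose[OF T S] in simp_all)
  then obtain w where w: "w \<in> space ?R" and AEw: "AE p in M \<Otimes>\<^sub>M M. ?S (?T (p, w)) = \<kappa>"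
    using R.AE_imp_ex_in_space by blast
  \<comment> \<open>The arcs in \<open>A2\<close> meet the head of \<open>a\<close> and hence miss its tail, so that \<open>\<alpha>\<close> may absorb the arcs
    in \<open>A1\<close> and \<open>\<beta>\<close> those in \<open>A2\<close>.\<close>
  define A1 where "A1 = {e \<in> arcs D - {a}. j \<notin> {tail D e, head D e}}"
  define A2 where "A2 = {e \<in> arcs D - {a}. j \<in> {tail D e, head D e}}"
  define \<alpha> where "\<alpha> x = \<kappa> - (\<Sum>e\<in>A1. f ((w(i := x)) (tail D e), (w(i := x)) (head D e)))" for x
  define \<beta> where "\<beta> y = - (\<Sum>e\<in>A2. f ((w(j := y)) (tail D e), (w(j := y)) (head D e)))" for y
  have wM: "w k \<in> space M" if "k \<in> ?V" "k \<noteq> i" "k \<noteq> j" for k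
    using w that by (auto simp: space_PiM)
  have mi: "(\<lambda>x. (w(i := x)) k) \<in> M \<rightarrow>\<^sub>M M" if "k \<in> ?V" "k \<noteq> j" for k
    using wM[of k] that by (cases "k = i") auto
  have mj: "(\<lambda>x. (w(j := x)) k) \<in> M \<rightarrow>\<^sub>M M" if "k \<in> ?V" "k \<noteq> i" for k
    using wM[of k] that by (cases "k = j") auto
  have fin: "finite (arcs D)" by simp
  have A12: "finite A1" "finite A2" "A1 \<inter> A2 = {}" "arcs D = insert a (A1 \<union> A2)" "a \<notin> A1 \<union> A2"
    using a fin by (auto simp: A1_def A2_def)
  show thesis
  proof
    show "\<alpha> \<in> borel_measurable M"
      unfolding \<alpha>_def
      by (intro borel_measurable_diff borel_measurable_const borel_measurable_sum
          measurable_compose[OF _ f] measurable_Pair mi) (auto simp: A1_def)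
    have "i \<notin> {tail D e, head D e}" if "e \<in> A2" for e using other[of e] that by (auto simp: A2_def)
    then show "\<beta> \<in> borel_measurable M"
      unfolding \<beta>_def
      by (intro borel_measurable_uminus borel_measurable_sum
          measurable_compose[OF _ f] measurable_Pair mj) (auto simp: A2_def)
    show "\<bar>\<alpha> x\<bar> \<le> \<bar>\<kappa>\<bar> + card A1 * C" for x
    proof -
      have "\<bar>\<Sum>e\<in>A1. f ((w(i := x)) (tail D e), (w(i := x)) (head D e))\<bar> \<le> (\<Sum>e\<in>A1. C)"
        by (rule order_trans[OF sum_abs sum_mono]) (rule bnd)
      then show ?thesis by (simp add: \<alpha>_def)
    qed
    have "?S (?T (p, w)) = f p + (\<kappa> - \<alpha> (fst p)) + - \<beta> (snd p)" for p
    proof -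
      have "?S (?T (p, w)) = f p
         + (\<Sum>e\<in>A1. f (?T (p, w) (tail D e), ?T (p, w) (head D e)))
         + (\<Sum>e\<in>A2. f (?T (p, w) (tail D e), ?T (p, w) (head D e)))"
        using A12 ij by (simp add: sum.union_disjoint i_def[symmetric] j_def[symmetric] split_beta)
      also have "(\<Sum>e\<in>A1. f (?T (p, w) (tail D e), ?T (p, w) (head D e))) = \<kappa> - \<alpha> (fst p)"
        unfolding \<alpha>_def by (auto simp: split_beta A1_def intro!: sum.cong)
      also have "(\<Sum>e\<in>A2. f (?T (p, w) (tail D e), ?T (p, w) (head D e))) = - \<beta> (snd p)"
      proof -
        have "(\<Sum>e\<in>A2. f (?T (p, w) (tail D e), ?T (p, w) (head D e))) =
            (\<Sum>e\<in>A2. f ((w(j := snd p)) (tail D e), (w(j := snd p)) (head D e)))"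
        proof (rule sum.cong[OF refl])
          fix e assume e: "e \<in> A2"
          then have "i \<noteq> tail D e" "i \<noteq> head D e" using other[of e] by (auto simp: A2_def)
          then show "f (?T (p, w) (tail D e), ?T (p, w) (head D e)) =
              f ((w(j := snd p)) (tail D e), (w(j := snd p)) (head D e))"
            by (simp add: split_beta)
        qed
        then show ?thesis by (simp add: \<beta>_def)
      qed
      finally show ?thesis .
    qed
    with AEw show "AE p in M \<Otimes>\<^sub>M M. f p = \<alpha> (fst p) + \<beta> (snd p)"
      by (auto elim!: eventually_mono)
  qed
qed

text \<open>Write \<open>f(x, y) = \<alpha>(x) + \<beta>(y)\<close>. The arc sum becomes the sum over the vertices \<open>v\<close> of
  \<open>d\<^sup>+(v) \<alpha> + d\<^sup>-(v) \<beta>\<close>, evaluated at the coordinate of \<open>v\<close>, so each of these functions is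
  constant. Adding them over all \<open>v\<close> shows that \<open>\<alpha> + \<beta>\<close> is constant, because in- and outdegrees
  both add up to the number of arcs. Substituting \<open>\<beta> = const - \<alpha>\<close> back, \<open>(d\<^sup>+(v) - d\<^sup>-(v)) \<alpha>\<close> is
  constant for each \<open>v\<close>, and one unbalanced vertex makes \<open>\<alpha>\<close> itself constant.\<close>

theorem (in prob_space) AE_arc_sum_const_imp_potential:
  fixes f :: "'a \<times> 'a \<Rightarrow> real" and D :: "('v, 'e) pre_digraph"
  assumes "oriented_graph D" and a: "arcs D \<noteq> {}"
    and f[measurable]: "f \<in> borel_measurable (M \<Otimes>\<^sub>M M)" and bnd: "\<And>p. \<bar>f p\<bar> \<le> C"
    and AE: "AE z in PiM (verts D) (\<lambda>_. M). (\<Sum>e\<in>arcs D. f (z (tail D e), z (head D e))) = \<kappa>"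
  obtains \<alpha> B where "\<alpha> \<in> borel_measurable M" "\<And>x. \<bar>\<alpha> x\<bar> \<le> B"
    "AE p in M \<Otimes>\<^sub>M M. f p = \<kappa> / card (arcs D) + \<alpha> (fst p) - \<alpha> (snd p)"
    "\<not> eulerian D \<Longrightarrow> AE p in M \<Otimes>\<^sub>M M. f p = \<kappa> / card (arcs D)"
proof -
  interpret D: oriented_graph D by fact
  interpret P: prob_space "PiM (verts D) (\<lambda>_. M)" by (rule prob_space_PiM) (rule prob_space_axioms)
  define m where "m = real (card (arcs D))"
  have m: "m > 0" using a by (simp add: m_def card_gt_0_iff)
  from a obtain a0 where "a0 \<in> arcs D" by blast
  from AE_arc_sum_const_imp_separable[OF assms(1) this f bnd AE]
  obtain \<alpha> \<beta> B where \<alpha>[measurable]: "\<alpha> \<in> borel_measurable M" and \<beta>[measurable]: "\<beta> \<in> borel_measurable M"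
    and B: "\<And>x. \<bar>\<alpha> x\<bar> \<le> B" and sep: "AE p in M \<Otimes>\<^sub>M M. f p = \<alpha> (fst p) + \<beta> (snd p)"
    by blast
  define g where "g v x = real (out_degree D v) * \<alpha> x + real (in_degree D v) * \<beta> x" for v x
  have g[measurable]: "g v \<in> borel_measurable M" for v unfolding g_def by measurable
  have "AE z in PiM (verts D) (\<lambda>_. M). f (z (tail D e), z (head D e)) = \<alpha> (z (tail D e)) + \<beta> (z (head D e))"
    if e: "e \<in> arcs D" for e
  proof -
    have e': "tail D e \<in> verts D" "head D e \<in> verts D" "tail D e \<noteq> head D e"
      using e D.no_loops by auto
    have "(\<lambda>z. (z (tail D e), z (head D e))) \<in> PiM (verts D) (\<lambda>_. M) \<rightarrow>\<^sub>M M \<Otimes>\<^sub>M M"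
      using e' by (intro measurable_Pair measurable_component_singleton)
    from AE_measure_preserving[OF this distr_pair_components_PiM[OF D.finite_verts e'] sep]
    show ?thesis by simp
  qed
  then have "AE z in PiM (verts D) (\<lambda>_. M). \<forall>e\<in>arcs D. f (z (tail D e), z (head D e)) = \<alpha> (z (tail D e)) + \<beta> (z (head D e))"
    by (intro AE_finite_allI) auto
  with AE have AEg: "AE z in PiM (verts D) (\<lambda>_. M). (\<Sum>v\<in>verts D. g v (z v)) = \<kappa>"
  proof eventually_elim
    case (elim z)
    have "(\<Sum>v\<in>verts D. g v (z v)) = (\<Sum>e\<in>arcs D. \<alpha> (z (tail D e)) + \<beta> (z (head D e)))"
      by (simp add: g_def sum.distrib D.sum_tail_eq_sum_out_degree[of "\<lambda>v. \<alpha> (z v)"]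
          D.sum_head_eq_sum_in_degree[of "\<lambda>v. \<beta> (z v)"])
    with elim show ?case by simp
  qed
  have "\<exists>c. \<forall>v\<in>verts D. AE x in M. g v x = c v"
    using AE_sum_components_const_imp_AE_const[OF D.finite_verts _ AEg] g by (intro bchoice) blast
  then obtain c where c: "\<And>v. v \<in> verts D \<Longrightarrow> AE x in M. g v x = c v" by blast
  have sumg: "(\<Sum>v\<in>verts D. g v x) = m * (\<alpha> x + \<beta> x)" for x
    using D.sum_tail_eq_sum_out_degree[of "\<lambda>_. \<alpha> x"] D.sum_head_eq_sum_in_degree[of "\<lambda>_. \<beta> x"]
    by (simp add: g_def sum.distrib m_def distrib_left)
  have allc: "AE x in M. \<forall>v\<in>verts D. g v x = c v" using c by (intro AE_finite_allI) auto
  have "AE z in PiM (verts D) (\<lambda>_. M). \<forall>v\<in>verts D. g v (z v) = c v"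
    using c by (intro AE_finite_allI AE_PiM_component) (auto intro: prob_space_axioms)
  with AEg have "AE z in PiM (verts D) (\<lambda>_. M). (\<Sum>v\<in>verts D. c v) = \<kappa>"
    by eventually_elim simp
  then have sumc: "(\<Sum>v\<in>verts D. c v) = \<kappa>" by simp
  have \<beta>_eq: "AE x in M. \<beta> x = \<kappa> / m - \<alpha> x"
    using allc
  proof eventually_elim
    case (elim x)
    then have "m * (\<alpha> x + \<beta> x) = \<kappa>" using sumg[of x] sumc by simp
    then show ?case using m by (simp add: field_simps)
  qed
  have main: "AE p in M \<Otimes>\<^sub>M M. f p = \<kappa> / m + \<alpha> (fst p) - \<alpha> (snd p)"
    using sep AE_pair_sndI[OF \<beta>_eq] by eventually_elim simp
  show thesis
  proof (rule that[OF \<alpha> B])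
    show "AE p in M \<Otimes>\<^sub>M M. f p = \<kappa> / card (arcs D) + \<alpha> (fst p) - \<alpha> (snd p)"
      using main by (simp add: m_def)
    assume "\<not> eulerian D"
    then obtain v where v: "v \<in> verts D" "in_degree D v \<noteq> out_degree D v" by (auto simp: eulerian_def)
    define d where "d = real (out_degree D v) - real (in_degree D v)"
    have d: "d \<noteq> 0" using v by (simp add: d_def)
    have \<alpha>c: "AE x in M. \<alpha> x = (c v - real (in_degree D v) * (\<kappa> / m)) / d"
      using c[OF v(1)] \<beta>_eq
    proof eventually_elim
      case (elim x)
      then have "d * \<alpha> x = c v - real (in_degree D v) * (\<kappa> / m)"
        by (simp add: g_def d_def algebra_simps)
      then show ?case using d by (simp add: field_simps)
    qed
    show "AE p in M \<Otimes>\<^sub>M M. f p = \<kappa> / card (arcs D)"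
      using main AE_pair_fstI[OF \<alpha>c] AE_pair_sndI[OF \<alpha>c] by eventually_elim (simp add: m_def)
  qed
qed

section \<open>Densities over a probability measure and the entropy argument\<close>

text \<open>Where \<open>h = t * exp L\<close>, the integrand \<open>(h - t) * L\<close> is \<open>t * (exp L - 1) * L\<close>, which is
  nonnegative and vanishes only at \<open>L = 0\<close>. For a probability density \<open>h / t\<close> the integral is
  \<open>t\<close> times the sum of the two relative entropies between \<open>h / t\<close> and the constant density 1, so
  this is the equality case of Gibbs' inequality, in symmetrised form.\<close>

lemma (in prob_space) AE_zero_if_covariance_with_exp_zero:
  fixes L h :: "'a \<Rightarrow> real"
  assumes [measurable]: "L \<in> borel_measurable M"
    and bnd: "\<And>z. \<bar>L z\<bar> \<le> C" and t: "t > 0"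
    and h: "AE z in M. h z = t * exp (L z)" and [measurable]: "h \<in> borel_measurable M"
    and cov: "(\<integral>z. (h z - t) * L z \<partial>M) = 0"
  shows "AE z in M. L z = 0"
proof -
  have pos: "(exp u - 1) * u \<ge> 0" for u :: real
    by (cases "u \<ge> 0") (auto intro: mult_nonneg_nonneg mult_nonpos_nonpos)
  have int: "integrable M (\<lambda>z. t * ((exp (L z) - 1) * L z))"
  proof (rule integrable_const_bound[where B="t * ((exp C + 1) * C)"])
    show "AE z in M. norm (t * ((exp (L z) - 1) * L z)) \<le> t * ((exp C + 1) * C)"
    proof (rule AE_I2)
      fix z
      have "\<bar>exp (L z) - 1\<bar> \<le> exp C + 1"
        using bnd[of z] exp_gt_zero[of "L z"] by (smt (verit) exp_le_cancel_iff)
      then show "norm (t * ((exp (L z) - 1) * L z)) \<le> t * ((exp C + 1) * C)"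
        using bnd[of z] t by (auto simp: abs_mult intro!: mult_mono add_nonneg_nonneg)
    qed
  qed measurable
  have "(\<integral>z. t * ((exp (L z) - 1) * L z) \<partial>M) = (\<integral>z. (h z - t) * L z \<partial>M)"
    by (intro integral_cong_AE) (use h in \<open>auto elim!: eventually_mono simp: algebra_simps\<close>)
  then have "(\<integral>z. t * ((exp (L z) - 1) * L z) \<partial>M) = 0" using cov by simp
  then have "AE z in M. t * ((exp (L z) - 1) * L z) = 0"
    using integral_nonneg_eq_0_iff_AE[OF int] t pos by (auto simp: mult_nonneg_nonneg)
  then show ?thesis by eventually_elim (use t in auto)
qed
text \<open>The arc-rooted density with an arbitrary probability measure on the reals in place of
  (completed) Lebesgue measure. Working with uncompleted product measures gives access to
  Fubini's theorem for functions measurable with respect to the product sigma-algebra.\<close>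

definition rooted_density :: "real measure \<Rightarrow> ('v, 'e) pre_digraph \<Rightarrow> (real \<Rightarrow> real \<Rightarrow> real) \<Rightarrow> 'e \<Rightarrow> real \<times> real \<Rightarrow> real" where
  "rooted_density M D W a p =
     (LINT z|PiM (verts D - {tail D a, head D a}) (\<lambda>_. M).
        arc_product D W (z(tail D a := fst p, head D a := snd p)))"

lemma (in wf_digraph) measurable_arc_product:
  assumes "(\<lambda>p. W (fst p) (snd p)) \<in> borel_measurable (M \<Otimes>\<^sub>M M)"
  shows "arc_product G W \<in> borel_measurable (PiM (verts G) (\<lambda>_. M))"
proof -
  have "(\<lambda>z. W (z (tail G e)) (z (head G e))) \<in> borel_measurable (PiM (verts G) (\<lambda>_. M))"
    if "e \<in> arcs G" for e
  proof -
    have "(\<lambda>z. (z (tail G e), z (head G e))) \<in> PiM (verts G) (\<lambda>_. M) \<rightarrow>\<^sub>M M \<Otimes>\<^sub>M M"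
      using that by (intro measurable_Pair measurable_component_singleton) auto
    from measurable_compose[OF this assms] show ?thesis by simp
  qed
  then show ?thesis unfolding arc_product_def[abs_def] by (intro borel_measurable_prod)
qed

lemma arc_product_bounds:
  assumes "\<And>e. e \<in> arcs D \<Longrightarrow> W (z (tail D e)) (z (head D e)) \<in> {0..1}"
  shows "arc_product D W z \<in> {0..1}"
  using assms unfolding arc_product_def by (auto intro!: prod_nonneg prod_le_1)

lemma (in fin_digraph) arc_product_le_factor:
  assumes "\<And>x y. W x y \<in> {0..1}" "a \<in> arcs G"
  shows "arc_product G W z \<le> W (z (tail G a)) (z (head G a))"
proof -
  have "(\<Prod>e\<in>arcs G - {a}. W (z (tail G e)) (z (head G e))) \<in> {0..1}"
    using assms(1) by (auto intro!: prod_nonneg prod_le_1)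
  then show ?thesis
    using assms by (auto simp: arc_product_def prod.remove[of "arcs G" a] intro!: mult_left_le)
qed

locale kernel_density = M: prob_space M + D: oriented_graph D
  for M :: "real measure" and D :: "('v, 'e) pre_digraph" +
  fixes W :: "real \<Rightarrow> real \<Rightarrow> real"
  assumes meas_W [measurable]: "(\<lambda>p. W (fst p) (snd p)) \<in> borel_measurable (M \<Otimes>\<^sub>M M)"
    and W_range: "\<And>x y. W x y \<in> {0..1}"
begin

abbreviation "P \<equiv> PiM (verts D) (\<lambda>_. M)"

abbreviation "t \<equiv> (LINT z|P. arc_product D W z)"

sublocale P: prob_space P by (rule prob_space_PiM) (rule M.prob_space_axioms)

sublocale MM: pair_prob_space M M ..

lemma meas_arc_product [measurable]: "arc_product D W \<in> borel_measurable P"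
  by (rule D.measurable_arc_product[OF meas_W])

lemma arc_product_range: "arc_product D W z \<in> {0..1}"
  by (rule arc_product_bounds) (rule W_range)

lemma measurable_arc_ends:
  assumes "a \<in> arcs D"
  shows "(\<lambda>z. (z (tail D a), z (head D a))) \<in> P \<rightarrow>\<^sub>M M \<Otimes>\<^sub>M M"
  using assms by (intro measurable_Pair measurable_component_singleton) auto

lemma distr_arc_ends:
  assumes "a \<in> arcs D"
  shows "distr P (M \<Otimes>\<^sub>M M) (\<lambda>z. (z (tail D a), z (head D a))) = M \<Otimes>\<^sub>M M"
  using assms D.no_loops by (intro M.distr_pair_components_PiM) auto

lemma t_le_1: "t \<le> 1"
proof -
  have "t \<le> (LINT z|P. 1)"
    using arc_product_range
    by (intro integral_mono P.integrable_const_bound[where B=1]) auto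
  then show ?thesis by (simp add: P.prob_space)
qed

lemma meas_rooted_density [measurable]:
  assumes a: "a \<in> arcs D"
  shows "rooted_density M D W a \<in> borel_measurable (M \<Otimes>\<^sub>M M)"
proof -
  define i j where "i = tail D a" and "j = head D a"
  have ij: "i \<in> verts D" "j \<in> verts D"
    using a unfolding i_def j_def by auto
  let ?R = "PiM (verts D - {i, j}) (\<lambda>_. M)"
  interpret R: prob_space ?R by (rule prob_space_PiM) (rule M.prob_space_axioms)
  have "(\<lambda>q. arc_product D W ((snd q)(i := fst (fst q), j := snd (fst q))))
      \<in> borel_measurable ((M \<Otimes>\<^sub>M M) \<Otimes>\<^sub>M ?R)"
    using measurable_compose[OF measurable_update2_PiM[OF ij] meas_arc_product] by (simp add: split_beta')
  then have "(\<lambda>p. LINT z|?R. arc_product D W (z(i := fst p, j := snd p))) \<in> borel_measurable (M \<Otimes>\<^sub>M M)"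
    by (intro R.borel_measurable_lebesgue_integral) (simp add: split_beta')
  then show ?thesis by (simp add: rooted_density_def[abs_def] i_def j_def)
qed

text \<open>Integrating out the vertices off the arc \<open>a\<close>. With \<open>rooted_density\<close> constant, this says
  that the probability density proportional to \<open>arc_product\<close> has the marginal \<open>M \<Otimes>\<^sub>M M\<close> on the
  ends of \<open>a\<close>.\<close>

lemma integral_arc_product_times:
  assumes a: "a \<in> arcs D" and g[measurable]: "g \<in> borel_measurable (M \<Otimes>\<^sub>M M)" and bnd: "\<And>p. \<bar>g p\<bar> \<le> C"
  shows "(LINT z|P. arc_product D W z * g (z (tail D a), z (head D a)))
    = (LINT p|(M \<Otimes>\<^sub>M M). rooted_density M D W a p * g p)"
proof -
  define i j where "i = tail D a" and "j = head D a"
  have ij: "i \<in> verts D" "j \<in> verts D" "i \<noteq> j"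
    using a D.no_loops unfolding i_def j_def by auto
  let ?R = "PiM (verts D - {i, j}) (\<lambda>_. M)"
  let ?T = "\<lambda>((x, y), z). z(i := x, j := y)"
  let ?F = "\<lambda>z. arc_product D W z * g (z i, z j)"
  interpret R: prob_space ?R by (rule prob_space_PiM) (rule M.prob_space_axioms)
  interpret MR: pair_prob_space "M \<Otimes>\<^sub>M M" ?R ..
  have T: "?T \<in> (M \<Otimes>\<^sub>M M) \<Otimes>\<^sub>M ?R \<rightarrow>\<^sub>M P"
    by (rule measurable_update2_PiM[OF ij(1,2)])
  have F: "?F \<in> borel_measurable P"
    using measurable_compose[OF measurable_arc_ends[OF a] g] by (auto simp: i_def j_def)
  have FT: "(\<lambda>q. ?F (?T q)) \<in> borel_measurable ((M \<Otimes>\<^sub>M M) \<Otimes>\<^sub>M ?R)"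
    by (rule measurable_compose[OF T F])
  have "\<bar>?F z\<bar> \<le> C" for z
    using arc_product_range[of z] bnd[of "(z i, z j)"]
      mult_mono[of "arc_product D W z" 1 "\<bar>g (z i, z j)\<bar>" C]
    by (auto simp: abs_mult)
  then have int: "integrable ((M \<Otimes>\<^sub>M M) \<Otimes>\<^sub>M ?R) (\<lambda>q. ?F (?T q))"
    by (intro MR.integrable_const_bound[where B=C] FT) auto
  have "(LINT z|P. ?F z) = (LINT z|distr ((M \<Otimes>\<^sub>M M) \<Otimes>\<^sub>M ?R) P ?T. ?F z)"
    by (simp only: M.distr_update2_PiM[OF D.finite_verts ij])
  also have "\<dots> = (LINT q|((M \<Otimes>\<^sub>M M) \<Otimes>\<^sub>M ?R). ?F (?T q))"
    by (rule integral_distr[OF T F])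
  also have "\<dots> = (LINT p|(M \<Otimes>\<^sub>M M). LINT z|?R. ?F (?T (p, z)))"
    by (rule MR.integral_fst'[OF int, symmetric])
  also have "\<dots> = (LINT p|(M \<Otimes>\<^sub>M M). rooted_density M D W a p * g p)"
    using ij by (simp add: split_beta rooted_density_def i_def[symmetric] j_def[symmetric])
  finally show ?thesis by (simp add: i_def j_def)
qed

lemma rooted_density_le:
  assumes "a \<in> arcs D"
  shows "rooted_density M D W a p \<le> W (fst p) (snd p)"
proof -
  interpret R: prob_space "PiM (verts D - {tail D a, head D a}) (\<lambda>_. M)"
    by (rule prob_space_PiM) (rule M.prob_space_axioms)
  have le: "arc_product D W (z(tail D a := fst p, head D a := snd p)) \<le> W (fst p) (snd p)" for z
    using D.arc_product_le_factor[OF W_range assms, where z="z(tail D a := fst p, head D a := snd p)"]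
      assms D.no_loops by auto
  show ?thesis
  proof (cases "integrable (PiM (verts D - {tail D a, head D a}) (\<lambda>_. M))
      (\<lambda>z. arc_product D W (z(tail D a := fst p, head D a := snd p)))")
    case True
    then have "rooted_density M D W a p \<le> (LINT z|PiM (verts D - {tail D a, head D a}) (\<lambda>_. M). W (fst p) (snd p))"
      unfolding rooted_density_def by (intro integral_mono) (auto simp: le)
    then show ?thesis by (simp add: R.prob_space)
  next
    case False
    then show ?thesis using W_range by (auto simp: rooted_density_def not_integrable_integral_eq)
  qed
qed

end

locale constant_rooted_densities = kernel_density M D W
  for M :: "real measure" and D :: "('v, 'e) pre_digraph" and W +
  assumes const: "\<And>a. a \<in> arcs D \<Longrightarrow> \<exists>c. AE p in M \<Otimes>\<^sub>M M. rooted_density M D W a p = c"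
    and t_pos: "t > 0"
begin

lemma AE_rooted_density_eq:
  assumes a: "a \<in> arcs D"
  shows "AE p in M \<Otimes>\<^sub>M M. rooted_density M D W a p = t"
proof -
  obtain c where c: "AE p in M \<Otimes>\<^sub>M M. rooted_density M D W a p = c" using const[OF a] by blast
  have "t = (LINT p|(M \<Otimes>\<^sub>M M). rooted_density M D W a p)"
    using integral_arc_product_times[OF a, of "\<lambda>_. 1" 1] by simp
  also have "\<dots> = (LINT p|(M \<Otimes>\<^sub>M M). c)"
    by (rule Bochner_Integration.integral_cong_AE) (use a c in auto)
  finally have "t = c" by (simp add: MM.prob_space)
  with c show ?thesis by simp
qed


text \<open>A kernel with constant rooted densities is bounded away from zero, since all other factors of
  the rooted density are at most 1. This makes the logarithm of the kernel bounded.\<close>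

lemma AE_kernel_ge:
  assumes a: "a \<in> arcs D"
  shows "AE p in M \<Otimes>\<^sub>M M. W (fst p) (snd p) \<ge> t"
  using AE_rooted_density_eq[OF a] by eventually_elim (metis rooted_density_le[OF a])

text \<open>The truncation at \<open>t\<close> changes the kernel on a null set only and makes the logarithm bounded
  everywhere.\<close>

definition log_kernel :: "real \<times> real \<Rightarrow> real" where
  "log_kernel p = ln (max t (W (fst p) (snd p)))"

lemma meas_log_kernel [measurable]: "log_kernel \<in> borel_measurable (M \<Otimes>\<^sub>M M)"
  unfolding log_kernel_def[abs_def] by measurable

lemma abs_log_kernel_le: "\<bar>log_kernel p\<bar> \<le> - ln t"
proof -
  have "ln t \<le> log_kernel p" using t_pos by (simp add: log_kernel_def)
  moreover have "log_kernel p \<le> 0"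
    using t_pos t_le_1 W_range[of "fst p" "snd p"] by (simp add: log_kernel_def)
  ultimately show ?thesis by simp
qed

text \<open>The entropy argument. Let \<open>h = arc_product D W = t * exp L\<close>, where \<open>L + ln t\<close> is the sum over
  the arcs of the logarithm of \<open>W\<close>. The integral of \<open>(h - t) * L\<close> can be computed arc by arc, and
  each arc contributes zero, because \<open>h / t\<close> and the constant density 1 have the same marginal on
  it. Hence \<open>L = 0\<close> almost everywhere.\<close>

lemma AE_arc_sum_log_kernel:
  "AE z in P. (\<Sum>e\<in>arcs D. log_kernel (z (tail D e), z (head D e))) = ln t"
proof -
  define l where "l e z = log_kernel (z (tail D e), z (head D e))" for e and z :: "'v \<Rightarrow> real"
  define L where "L z = (\<Sum>e\<in>arcs D. l e z) - ln t" for z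
  have l[measurable]: "l e \<in> borel_measurable P" if "e \<in> arcs D" for e
    unfolding l_def[abs_def] by (rule measurable_compose[OF measurable_arc_ends[OF that] meas_log_kernel])
  have L[measurable]: "L \<in> borel_measurable P"
    unfolding L_def[abs_def] by (intro borel_measurable_diff borel_measurable_sum l) auto
  have lb: "\<bar>l e z\<bar> \<le> - ln t" for e z unfolding l_def by (rule abs_log_kernel_le)
  have Lb: "\<bar>L z\<bar> \<le> card (arcs D) * (- ln t) + \<bar>ln t\<bar>" for z
  proof -
    have "\<bar>\<Sum>e\<in>arcs D. l e z\<bar> \<le> (\<Sum>e\<in>arcs D. - ln t)"
      by (rule order_trans[OF sum_abs sum_mono]) (rule lb)
    then show ?thesis unfolding L_def by simp
  qed
  have "AE z in P. W (z (tail D e)) (z (head D e)) \<ge> t" if e: "e \<in> arcs D" for e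
    using AE_measure_preserving[OF measurable_arc_ends[OF e] distr_arc_ends[OF e] AE_kernel_ge[OF e]]
    by simp
  then have "AE z in P. \<forall>e\<in>arcs D. W (z (tail D e)) (z (head D e)) \<ge> t"
    by (intro AE_finite_allI) auto
  then have hL: "AE z in P. arc_product D W z = t * exp (L z)"
  proof eventually_elim
    case (elim z)
    have "(\<Sum>e\<in>arcs D. l e z) = (\<Sum>e\<in>arcs D. ln (W (z (tail D e)) (z (head D e))))"
      using elim by (intro sum.cong) (auto simp: l_def log_kernel_def max_def)
    also have "\<dots> = ln (arc_product D W z)"
      unfolding arc_product_def using elim t_pos by (subst ln_prod) (auto intro: less_le_trans)
    finally have "L z = ln (arc_product D W z) - ln t" by (simp add: L_def)
    moreover have "arc_product D W z > 0"
      unfolding arc_product_def using elim t_pos by (intro prod_pos) (auto intro: less_le_trans)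
    ultimately show ?case using t_pos by (simp add: exp_diff)
  qed
  have h_int: "integrable P (arc_product D W)"
    by (rule P.integrable_const_bound[where B=1]) (use arc_product_range in auto)
  have l_int: "integrable P (l e)" if "e \<in> arcs D" for e
    by (rule P.integrable_const_bound[where B="- ln t"]) (use lb that in auto)
  have hl_int: "integrable P (\<lambda>z. arc_product D W z * l e z)" if e: "e \<in> arcs D" for e
  proof (rule P.integrable_const_bound[where B="- ln t"])
    have "\<bar>arc_product D W z * l e z\<bar> \<le> 1 * (- ln t)" for z
      unfolding abs_mult using arc_product_range[of z] lb[of e z] by (intro mult_mono) auto
    then show "AE z in P. norm (arc_product D W z * l e z) \<le> - ln t" by simp
    show "(\<lambda>z. arc_product D W z * l e z) \<in> borel_measurable P" using e by measurable
  qed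
  have hl: "(LINT z|P. arc_product D W z * l e z) = t * (LINT z|P. l e z)" if e: "e \<in> arcs D" for e
  proof -
    have "(LINT z|P. arc_product D W z * l e z)
        = (LINT p|(M \<Otimes>\<^sub>M M). rooted_density M D W e p * log_kernel p)"
      unfolding l_def by (rule integral_arc_product_times[OF e meas_log_kernel abs_log_kernel_le])
    also have "\<dots> = (LINT p|(M \<Otimes>\<^sub>M M). t * log_kernel p)"
      by (rule Bochner_Integration.integral_cong_AE)
        (use e AE_rooted_density_eq[OF e] in \<open>auto elim!: eventually_mono\<close>)
    also have "\<dots> = t * (LINT p|(M \<Otimes>\<^sub>M M). log_kernel p)" by simp
    also have "(LINT p|(M \<Otimes>\<^sub>M M). log_kernel p)
        = (LINT p|distr P (M \<Otimes>\<^sub>M M) (\<lambda>z. (z (tail D e), z (head D e))). log_kernel p)"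
      by (simp only: distr_arc_ends[OF e])
    also have "\<dots> = (LINT z|P. l e z)"
      unfolding l_def by (rule integral_distr[OF measurable_arc_ends[OF e] meas_log_kernel])
    finally show ?thesis .
  qed
  have "(LINT z|P. (arc_product D W z - t) * L z)
      = (LINT z|P. (\<Sum>e\<in>arcs D. arc_product D W z * l e z - t * l e z) - (arc_product D W z - t) * ln t)"
    by (intro Bochner_Integration.integral_cong refl)
      (simp add: L_def sum_subtractf sum_distrib_left left_diff_distrib right_diff_distrib)
  also have "\<dots> = (\<Sum>e\<in>arcs D. (LINT z|P. arc_product D W z * l e z) - t * (LINT z|P. l e z)) - (t - t) * ln t"
    using h_int l_int hl_int by (simp add: P.prob_space)
  also have "\<dots> = 0" using hl by simp
  finally have "AE z in P. L z = 0"
    using P.AE_zero_if_covariance_with_exp_zero[OF L Lb t_pos hL meas_arc_product] by blast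
  then show ?thesis by eventually_elim (simp add: L_def l_def)
qed

text \<open>Exponentiating the potential form of \<open>log_kernel\<close>; its additive constant \<open>ln t / m\<close>, for
  \<open>m\<close> arcs, becomes the \<open>m\<close>-th root of \<open>t\<close>.\<close>

theorem kernel_eq_potential:
  assumes "arcs D \<noteq> {}"
  defines "p \<equiv> root (card (arcs D)) t"
  obtains \<alpha> B where "\<alpha> \<in> borel_measurable M" "\<And>x. \<bar>\<alpha> x\<bar> \<le> B"
    "AE q in M \<Otimes>\<^sub>M M. W (fst q) (snd q) = p * exp (\<alpha> (fst q) - \<alpha> (snd q))"
    "\<not> eulerian D \<Longrightarrow> AE q in M \<Otimes>\<^sub>M M. W (fst q) (snd q) = p"
proof -
  define m where "m = card (arcs D)"
  have m: "m > 0" using assms(1) by (simp add: m_def card_gt_0_iff)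
  have p: "p = exp (ln t / m)"
    using m t_pos by (simp add: p_def m_def[symmetric] root_powr_inverse powr_def)
  obtain a where "a \<in> arcs D" using assms(1) by blast
  then have W: "AE q in M \<Otimes>\<^sub>M M. W (fst q) (snd q) = exp (log_kernel q)"
    using AE_kernel_ge by (auto elim!: eventually_mono simp: log_kernel_def max_def less_le_trans[OF t_pos])
  obtain \<alpha> B where \<alpha>: "\<alpha> \<in> borel_measurable M" "\<And>x. \<bar>\<alpha> x\<bar> \<le> B"
    and AE: "AE q in M \<Otimes>\<^sub>M M. log_kernel q = ln t / m + \<alpha> (fst q) - \<alpha> (snd q)"
    "\<not> eulerian D \<Longrightarrow> AE q in M \<Otimes>\<^sub>M M. log_kernel q = ln t / m"
    using M.AE_arc_sum_const_imp_potential[OF D.oriented_graph_axioms assms(1) meas_log_kernel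
        abs_log_kernel_le AE_arc_sum_log_kernel] unfolding m_def by blast
  show thesis
  proof (rule that[OF \<alpha>])
    show "AE q in M \<Otimes>\<^sub>M M. W (fst q) (snd q) = p * exp (\<alpha> (fst q) - \<alpha> (snd q))"
      using W AE(1) by eventually_elim (simp add: p exp_add[symmetric] add_diff_eq)
    assume "\<not> eulerian D"
    from AE(2)[OF this] W show "AE q in M \<Otimes>\<^sub>M M. W (fst q) (snd q) = p"
      by eventually_elim (simp add: p)
  qed
qed

end

section \<open>Completions\<close>

lemma completion_restrict_space:
  assumes S: "S \<in> sets M"
  shows "restrict_space (completion M) S = completion (restrict_space M S)"
proof (rule measure_eqI)
  have null_iff: "N \<in> null_sets (restrict_space M S) \<longleftrightarrow> N \<subseteq> S \<and> N \<in> null_sets M" for N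
    using S by (subst null_sets_restrict_space) auto
  show sets: "sets (restrict_space (completion M) S) = sets (completion (restrict_space M S))"
  proof (intro set_eqI iffI)
    fix A assume "A \<in> sets (restrict_space (completion M) S)"
    then have A: "A \<in> sets (completion M)" "A \<subseteq> S"
      using S by (auto simp: sets_restrict_space_iff)
    from A(1) obtain B N N' where BN: "A = B \<union> N" "N \<subseteq> N'" "N' \<in> null_sets M" "B \<in> sets M"
      by (rule sets_completionE)
    have "N' \<inter> S \<in> null_sets M" using BN(3) S by (rule null_set_Int2)
    then show "A \<in> sets (completion (restrict_space M S))"
      using BN A(2) S by (intro sets_completionI[where S=B and N=N and N'="N' \<inter> S"])
        (auto simp: null_iff sets_restrict_space_iff)
  next
    fix A assume "A \<in> sets (completion (restrict_space M S))"
    then obtain B N N' where "A = B \<union> N" "N \<subseteq> N'" "N' \<in> null_sets (restrict_space M S)" "B \<in> sets (restrict_space M S)"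
      by (rule sets_completionE)
    then show "A \<in> sets (restrict_space (completion M) S)"
      using S sets_completionI[of A B N N' M] by (simp add: sets_restrict_space_iff null_iff) blast
  qed
  fix A assume "A \<in> sets (restrict_space (completion M) S)"
  then have "A \<in> sets (completion (restrict_space M S))" unfolding sets .
  then obtain B N N' where BN: "A = B \<union> N" "N \<subseteq> N'" "N' \<in> null_sets (restrict_space M S)" "B \<in> sets (restrict_space M S)"
    by (rule sets_completionE)
  have B: "B \<subseteq> S" "B \<in> sets M" using BN(4) S by (auto simp: sets_restrict_space_iff)
  have N: "N \<in> null_sets (completion M)" "N \<in> null_sets (completion (restrict_space M S))" "N \<subseteq> S"
    using BN(2,3) by (auto simp: null_iff null_sets_completion_iff2)
  have "emeasure (restrict_space (completion M) S) A = emeasure (completion M) (B \<union> N)"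
    using BN(1) B N(3) S by (subst emeasure_restrict_space) auto
  also have "\<dots> = emeasure M B" using B N(1) by (subst emeasure_Un_null_set) auto
  also have "\<dots> = emeasure (completion (restrict_space M S)) (B \<union> N)"
    using BN(4) B N(2) S by (subst emeasure_Un_null_set) (auto simp: emeasure_restrict_space)
  finally show "emeasure (restrict_space (completion M) S) A = emeasure (completion (restrict_space M S)) A"
    using BN(1) by simp
qed

text \<open>Integrals of the original kernel are integrals of possibly non-Borel functions; this
  supplies the measurability that \<open>integral_cong_AE\<close> demands.\<close>

lemma borel_measurable_completion_AE_eq:
  fixes f g :: "'a \<Rightarrow> 'b::topological_space"
  assumes g: "g \<in> borel_measurable M" and AE: "AE x in M. f x = g x"
  shows "f \<in> borel_measurable (completion M)"
proof (rule borel_measurableI)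
  fix A :: "'b set" assume "open A"
  then have gA: "g -` A \<inter> space (completion M) \<in> sets (completion M)"
    using measurable_completion[OF g] by (intro measurable_sets) auto
  have eq: "AE x in completion M. x \<in> g -` A \<inter> space (completion M) \<longleftrightarrow> x \<in> f -` A \<inter> space (completion M)"
    by (rule eventually_mono[OF AE_completion[OF AE]]) simp
  show "f -` A \<inter> space (completion M) \<in> sets (completion M)"
    by (rule completion.in_sets_AE[OF eq gA]) simp
qed

lemma (in prob_space) distr_PiM_completion:
  assumes fin: "finite I"
  shows "distr (PiM I (\<lambda>_. completion M)) (PiM I (\<lambda>_. M)) (\<lambda>z. z) = PiM I (\<lambda>_. M)"
    and "(\<lambda>z. z) \<in> PiM I (\<lambda>_. completion M) \<rightarrow>\<^sub>M PiM I (\<lambda>_. M)"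
proof -
  have "prob_space (completion M)" by (rule prob_space_completion) 
  then interpret C: product_prob_space "\<lambda>_. completion M" by (intro product_prob_spaceI)
  interpret P: product_prob_space "\<lambda>_. M" by unfold_locales
  have id: "(\<lambda>z. z) \<in> completion M \<rightarrow>\<^sub>M M" by (rule measurable_completion) simp
  show meas: "(\<lambda>z. z) \<in> PiM I (\<lambda>_. completion M) \<rightarrow>\<^sub>M PiM I (\<lambda>_. M)"
  proof (rule measurable_PiM_single'[where f="\<lambda>i z. z i"])
    fix i assume "i \<in> I"
    then have "(\<lambda>z. z i) \<in> PiM I (\<lambda>_. completion M) \<rightarrow>\<^sub>M completion M"
      by (rule measurable_component_singleton)
    from measurable_compose[OF this id] show "(\<lambda>z. z i) \<in> PiM I (\<lambda>_. completion M) \<rightarrow>\<^sub>M M" by simp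
  qed (simp add: space_PiM)
  show "distr (PiM I (\<lambda>_. completion M)) (PiM I (\<lambda>_. M)) (\<lambda>z. z) = PiM I (\<lambda>_. M)"
  proof (rule P.PiM_eqI[OF fin])
    fix A assume A: "\<And>i. i \<in> I \<Longrightarrow> A i \<in> sets M"
    have sub: "Pi\<^sub>E I A \<subseteq> space (PiM I (\<lambda>_. completion M))"
      unfolding space_PiM by (rule PiE_mono) (use A sets.sets_into_space in auto)
    have "emeasure (distr (PiM I (\<lambda>_. completion M)) (PiM I (\<lambda>_. M)) (\<lambda>z. z)) (Pi\<^sub>E I A)
        = emeasure (PiM I (\<lambda>_. completion M)) (Pi\<^sub>E I A)"
      using sub A fin by (subst emeasure_distr[OF meas sets_PiM_I_finite]) (simp_all add: Int_absorb2)
    also have "\<dots> = (\<Prod>i\<in>I. emeasure (completion M) (A i))"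
      using A by (intro C.emeasure_PiM fin) auto
    also have "\<dots> = (\<Prod>i\<in>I. emeasure M (A i))"
      using A by (intro prod.cong) auto
    finally show "emeasure (distr (PiM I (\<lambda>_. completion M)) (PiM I (\<lambda>_. M)) (\<lambda>z. z)) (Pi\<^sub>E I A) = (\<Prod>i\<in>I. emeasure M (A i))" .
  qed simp
qed

section \<open>Lebesgue measurable kernels on the unit square\<close>

text \<open>Lebesgue measure on Borel subsets of \<open>[0,1]\<close>. All the completed measures in the definitions
  of the densities are completions of products built from it, so that statements about almost
  every point and integrals can be moved to it.\<close>

definition unit_interval :: "real measure" where
  "unit_interval = restrict_space lborel {0..1}"

lemma space_unit_interval [simp]: "space unit_interval = {0..1}"
  by (simp add: unit_interval_def space_restrict_space)

lemma prob_space_unit_interval: "prob_space unit_interval"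
  by (rule prob_spaceI) (simp add: unit_interval_def emeasure_restrict_space space_restrict_space)

interpretation U: prob_space unit_interval by (rule prob_space_unit_interval)

lemma lebesgue_on_unit_interval: "lebesgue_on {0..1} = completion unit_interval"
  by (simp add: unit_interval_def completion_restrict_space)

lemma unit_interval_pair: "unit_interval \<Otimes>\<^sub>M unit_interval = restrict_space lborel ({0..1} \<times> {0..1})"
proof (rule pair_measure_eqI)
  have S: "{0..1} \<times> {0..1} \<in> sets (borel :: (real \<times> real) measure)"
    by (intro borel_Times) auto
  show "sigma_finite_measure unit_interval" "sigma_finite_measure unit_interval"
    by unfold_locales
  show "sets (unit_interval \<Otimes>\<^sub>M unit_interval) = sets (restrict_space lborel ({0..1} \<times> {0..1}))"
  proof
    show "sets (unit_interval \<Otimes>\<^sub>M unit_interval) \<subseteq> sets (restrict_space lborel ({0..1} \<times> {0..1}))"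
      by (rule sets_pair_in_sets)
        (use S in \<open>auto simp: unit_interval_def sets_restrict_space_iff intro!: borel_Times\<close>)
    show "sets (restrict_space lborel ({0..1} \<times> {0..1})) \<subseteq> sets (unit_interval \<Otimes>\<^sub>M unit_interval)"
    proof
      fix X :: "(real \<times> real) set" assume "X \<in> sets (restrict_space lborel ({0..1} \<times> {0..1}))"
      then have X: "X \<in> sets borel" "X \<subseteq> {0..1} \<times> {0..1}"
        using S by (auto simp: sets_restrict_space_iff)
      have id: "(\<lambda>x. x) \<in> borel_measurable unit_interval"
        unfolding unit_interval_def by (intro measurable_restrict_space1) simp
      have "(\<lambda>p. (fst p, snd p)) \<in> borel_measurable (unit_interval \<Otimes>\<^sub>M unit_interval)"
        by (intro borel_measurable_Pair measurable_compose[OF measurable_fst id] measurable_compose[OF measurable_snd id])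
      from measurable_sets[OF this X(1)] X(2) show "X \<in> sets (unit_interval \<Otimes>\<^sub>M unit_interval)"
        by (simp add: space_pair_measure Int_absorb2)
    qed
  qed
  fix A B assume "A \<in> sets unit_interval" "B \<in> sets unit_interval"
  then have AB: "A \<subseteq> {0..1}" "B \<subseteq> {0..1}" "A \<in> sets borel" "B \<in> sets borel"
    by (auto simp: unit_interval_def sets_restrict_space_iff)
  then have "emeasure (restrict_space lborel ({0..1} \<times> {0..1})) (A \<times> B) = emeasure (lborel \<Otimes>\<^sub>M lborel) (A \<times> B)"
    using S by (subst emeasure_restrict_space) (auto simp: lborel_prod)
  also have "\<dots> = emeasure lborel A * emeasure lborel B"
    using AB by (intro lborel.emeasure_pair_measure_Times) auto
  finally show "emeasure unit_interval A * emeasure unit_interval B = emeasure (restrict_space lborel ({0..1} \<times> {0..1})) (A \<times> B)"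
    using AB by (simp add: unit_interval_def emeasure_restrict_space)
qed

lemma unit_square_measure_eq: "unit_square_measure = completion (unit_interval \<Otimes>\<^sub>M unit_interval)"
  unfolding unit_interval_pair
  by (rule completion_restrict_space) (simp add: borel_Times)

lemma unit_cube_measure_eq: "unit_cube_measure I = completion (PiM I (\<lambda>_. completion unit_interval))"
  by (simp add: unit_cube_measure_def lebesgue_on_unit_interval)

text \<open>The measure on the cube is completed twice, on each factor and on the product; neither
  completion affects the integral of a function that agrees almost everywhere with one
  measurable for the uncompleted product.\<close>

lemma integral_unit_cube_AE_eq:
  fixes f g :: "('v \<Rightarrow> real) \<Rightarrow> real"
  assumes fin: "finite I" and g: "g \<in> borel_measurable (PiM I (\<lambda>_. unit_interval))"
    and AE: "AE z in PiM I (\<lambda>_. unit_interval). f z = g z"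
  shows "(LINT z|unit_cube_measure I. f z) = (LINT z|PiM I (\<lambda>_. unit_interval). g z)"
proof -
  let ?Q = "PiM I (\<lambda>_. completion unit_interval)"
  note Q = U.distr_PiM_completion[OF fin]
  have gQ: "g \<in> borel_measurable ?Q" using measurable_compose[OF Q(2) g] .
  have AEQ: "AE z in ?Q. f z = g z" by (rule AE_measure_preserving[OF Q(2,1) AE])
  have "(LINT z|unit_cube_measure I. f z) = (LINT z|completion ?Q. g z)"
    unfolding unit_cube_measure_eq
    by (intro integral_cong_AE borel_measurable_completion_AE_eq[OF gQ AEQ] AE_completion AEQ
        measurable_completion gQ)
  also have "\<dots> = (LINT z|?Q. g z)" by (rule integral_completion[OF gQ])
  also have "\<dots> = (LINT z|distr ?Q (PiM I (\<lambda>_. unit_interval)) (\<lambda>z. z). g z)"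
    by (rule integral_distr[OF Q(2) g, symmetric])
  finally show ?thesis by (simp only: Q(1))
qed

context
  fixes D :: "('v, 'e) pre_digraph" and W W' :: "real \<Rightarrow> real \<Rightarrow> real"
  assumes ker: "kernel_density unit_interval D W'"
    and AE_W: "AE p in unit_interval \<Otimes>\<^sub>M unit_interval. W (fst p) (snd p) = W' (fst p) (snd p)"
begin

interpretation kernel_density unit_interval D W' by (rule ker)

lemma AE_arc_product_eq: "AE z in P. arc_product D W z = arc_product D W' z"
proof -
  have "AE z in P. W (z (tail D e)) (z (head D e)) = W' (z (tail D e)) (z (head D e))"
    if e: "e \<in> arcs D" for e
    using AE_measure_preserving[OF measurable_arc_ends[OF e] distr_arc_ends[OF e] AE_W] by simp
  then have "AE z in P. \<forall>e\<in>arcs D. W (z (tail D e)) (z (head D e)) = W' (z (tail D e)) (z (head D e))"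
    by (intro AE_finite_allI) auto
  then show ?thesis by eventually_elim (simp add: arc_product_def)
qed

lemma hom_density_eq: "hom_density D W = t"
  unfolding hom_density_def
  by (rule integral_unit_cube_AE_eq[OF D.finite_verts meas_arc_product AE_arc_product_eq])

lemma AE_arc_rooted_density_eq:
  assumes a: "a \<in> arcs D"
  shows "AE p in unit_interval \<Otimes>\<^sub>M unit_interval.
    arc_rooted_density D W a (fst p) (snd p) = rooted_density unit_interval D W' a p"
proof -
  define i j where "i = tail D a" and "j = head D a"
  have ij: "i \<in> verts D" "j \<in> verts D" "i \<noteq> j"
    using a D.no_loops unfolding i_def j_def by auto
  let ?R = "PiM (verts D - {i, j}) (\<lambda>_. unit_interval)"
  let ?T = "\<lambda>((x, y), z). z(i := x, j := y)"
  interpret R: prob_space ?R by (rule prob_space_PiM) (rule prob_space_unit_interval)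
  interpret MR: pair_prob_space "unit_interval \<Otimes>\<^sub>M unit_interval" ?R ..
  note T = measurable_update2_PiM[OF ij(1,2), of unit_interval]
  from AE_measure_preserving[OF T U.distr_update2_PiM[OF D.finite_verts ij] AE_arc_product_eq]
  have "AE q in (unit_interval \<Otimes>\<^sub>M unit_interval) \<Otimes>\<^sub>M ?R. arc_product D W (?T q) = arc_product D W' (?T q)" .
  from MR.AE_pair[OF this] AE_space
  show ?thesis
  proof eventually_elim
    case (elim p)
    have "(\<lambda>z. (p, z)) \<in> ?R \<rightarrow>\<^sub>M (unit_interval \<Otimes>\<^sub>M unit_interval) \<Otimes>\<^sub>M ?R"
      using elim(2) by measurable
    from measurable_compose[OF measurable_compose[OF this T] meas_arc_product]
    have "(\<lambda>z. arc_product D W' (z(i := fst p, j := snd p))) \<in> borel_measurable ?R"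
      by (simp add: split_beta)
    moreover have "AE z in ?R. arc_product D W (z(i := fst p, j := snd p)) = arc_product D W' (z(i := fst p, j := snd p))"
      using elim(1) by (simp add: split_beta)
    ultimately show ?case
      unfolding arc_rooted_density_def rooted_density_def i_def[symmetric] j_def[symmetric]
      by (intro integral_unit_cube_AE_eq) auto
  qed
qed

end

lemma directed_kernel_borel_version:
  assumes "directed_kernel W"
  obtains W' where "(\<lambda>p. W' (fst p) (snd p)) \<in> borel_measurable (unit_interval \<Otimes>\<^sub>M unit_interval)"
    "\<forall>x y. W' x y \<in> {0..1}"
    "AE p in unit_interval \<Otimes>\<^sub>M unit_interval. W (fst p) (snd p) = W' (fst p) (snd p)"
proof -
  have "(\<lambda>(x, y). W x y) \<in> borel_measurable (completion (unit_interval \<Otimes>\<^sub>M unit_interval))"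
    using assms by (simp add: directed_kernel_def unit_square_measure_eq)
  from completion_ex_borel_measurable_real[OF this]
  obtain g where [measurable]: "g \<in> borel_measurable (unit_interval \<Otimes>\<^sub>M unit_interval)"
    and g: "AE p in unit_interval \<Otimes>\<^sub>M unit_interval. (case p of (x, y) \<Rightarrow> W x y) = g p" by blast
  show thesis
  proof (rule that[of "\<lambda>x y. max 0 (min 1 (g (x, y)))"])
    show "(\<lambda>p. max 0 (min 1 (g (fst p, snd p)))) \<in> borel_measurable (unit_interval \<Otimes>\<^sub>M unit_interval)"
      by simp
    show "\<forall>x y. max 0 (min 1 (g (x, y))) \<in> {0..1}" by auto
    show "AE p in unit_interval \<Otimes>\<^sub>M unit_interval. W (fst p) (snd p) = max 0 (min 1 (g (fst p, snd p)))"
      using g AE_space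
    proof eventually_elim
      case (elim p)
      have "W (fst p) (snd p) \<in> {0..1}"
        using assms elim(2) by (auto simp: directed_kernel_def space_pair_measure)
      with elim(1) show ?case by (cases p) auto
    qed
  qed
qed

lemma AE_unit_square_iff:
  "(AE (x, y) in unit_square_measure. Q x y) \<longleftrightarrow> (AE p in unit_interval \<Otimes>\<^sub>M unit_interval. Q (fst p) (snd p))"
  unfolding unit_square_measure_eq AE_completion_iff split_beta ..

text \<open>Transfer of \<open>kernel_eq_potential\<close> to Lebesgue measurable kernels by way of a Borel version.\<close>

theorem constant_rooted_densities_imp_potential:
  assumes D: "oriented_graph D" and ne: "arcs D \<noteq> {}" and W: "directed_kernel W"
    and const: "\<And>a. a \<in> arcs D \<Longrightarrow> \<exists>c. AE (x, y) in unit_square_measure. arc_rooted_density D W a x y = c"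
    and pos: "hom_density D W > 0"
  defines "p \<equiv> root (card (arcs D)) (hom_density D W)"
  shows "\<not> eulerian D \<longrightarrow> (AE (x, y) in unit_square_measure. W x y = p)"
    and "p \<in> {0<..1}"
    and "\<exists>\<phi>. bounded_measurable \<phi> \<and> (AE (x, y) in unit_square_measure. W x y = p * exp (\<phi> x - \<phi> y))"
proof -
  interpret D: oriented_graph D by (rule D)
  obtain W' where W': "(\<lambda>p. W' (fst p) (snd p)) \<in> borel_measurable (unit_interval \<Otimes>\<^sub>M unit_interval)"
    "\<forall>x y. W' x y \<in> {0..1}"
    and AE: "AE p in unit_interval \<Otimes>\<^sub>M unit_interval. W (fst p) (snd p) = W' (fst p) (snd p)"
    using directed_kernel_borel_version[OF W] by blast
  interpret kernel_density unit_interval D W' by unfold_locales (use W' in auto)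
  note ker = kernel_density_axioms
  have t_eq: "t = hom_density D W" using hom_density_eq[OF ker AE] by simp
  interpret constant_rooted_densities unit_interval D W'
  proof unfold_locales
    show "t > 0" using pos by (simp add: t_eq)
    fix a assume a: "a \<in> arcs D"
    obtain c where "AE (x, y) in unit_square_measure. arc_rooted_density D W a x y = c"
      using const[OF a] by blast
    then have "AE p in unit_interval \<Otimes>\<^sub>M unit_interval. arc_rooted_density D W a (fst p) (snd p) = c"
      by (simp add: AE_unit_square_iff)
    with AE_arc_rooted_density_eq[OF ker AE a]
    have "AE p in unit_interval \<Otimes>\<^sub>M unit_interval. rooted_density unit_interval D W' a p = c"
      by eventually_elim simp
    then show "\<exists>c. AE p in unit_interval \<Otimes>\<^sub>M unit_interval. rooted_density unit_interval D W' a p = c" ..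
  qed
  obtain \<phi> B where \<phi>: "\<phi> \<in> borel_measurable unit_interval" "\<And>x. \<bar>\<phi> x\<bar> \<le> B"
    and form: "AE q in unit_interval \<Otimes>\<^sub>M unit_interval. W' (fst q) (snd q) = p * exp (\<phi> (fst q) - \<phi> (snd q))"
    and noneul: "\<not> eulerian D \<Longrightarrow> AE q in unit_interval \<Otimes>\<^sub>M unit_interval. W' (fst q) (snd q) = p"
    using kernel_eq_potential[OF ne] unfolding t_eq p_def by blast
  show "\<not> eulerian D \<longrightarrow> (AE (x, y) in unit_square_measure. W x y = p)"
    unfolding AE_unit_square_iff using AE noneul by (auto elim: eventually_elim2)
  have "card (arcs D) > 0" using ne by (simp add: card_gt_0_iff)
  then show "p \<in> {0<..1}" using pos t_le_1 by (simp add: p_def t_eq)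
  have "bounded_measurable \<phi>"
    unfolding bounded_measurable_def lebesgue_on_unit_interval
    using \<phi> by (auto intro!: measurable_completion boundedI)
  moreover have "AE (x, y) in unit_square_measure. W x y = p * exp (\<phi> x - \<phi> y)"
    unfolding AE_unit_square_iff using AE form by eventually_elim simp
  ultimately show "\<exists>\<phi>. bounded_measurable \<phi> \<and> (AE (x, y) in unit_square_measure. W x y = p * exp (\<phi> x - \<phi> y))"
    by blast
qed

section \<open>Potential kernels on Eulerian graphs\<close>

text \<open>The exponents telescope: each vertex contributes its potential once for every outgoing arc and
  minus once for every incoming one.\<close>

lemma (in fin_digraph) eulerian_arc_product_potential:
  assumes eul: "eulerian G"
    and W: "\<And>e. e \<in> arcs G \<Longrightarrow> W (z (tail G e)) (z (head G e)) = p * exp (\<phi> (z (tail G e)) - \<phi> (z (head G e)))"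
  shows "arc_product G W z = p ^ card (arcs G)"
proof -
  have deg: "in_degree G v = out_degree G v" if "v \<in> verts G" for v
    using eul that by (cases "isolated_vertex G v") (auto simp: eulerian_def isolated_vertex_def in_degree_def out_degree_def)
  have "(\<Sum>e\<in>arcs G. \<phi> (z (tail G e)) - \<phi> (z (head G e))) = 0"
    using sum_tail_eq_sum_out_degree[of "\<lambda>v. \<phi> (z v)"] sum_head_eq_sum_in_degree[of "\<lambda>v. \<phi> (z v)"] deg
    by (simp add: sum_subtractf)
  then show ?thesis
    unfolding arc_product_def using W by (simp add: prod.distrib exp_sum[symmetric])
qed

lemma prob_space_unit_cube: "prob_space (unit_cube_measure I)"
  unfolding unit_cube_measure_eq
  by (intro prob_space.prob_space_completion prob_space_PiM prob_space_unit_interval)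

theorem eulerian_rooted_density_potential:
  assumes D: "oriented_graph D" and eul: "eulerian D" and a: "a \<in> arcs D"
    and W: "\<And>x y. x \<in> {0..1} \<Longrightarrow> y \<in> {0..1} \<Longrightarrow> W x y = p * exp (\<phi> x - \<phi> y)"
    and xy: "x \<in> {0..1}" "y \<in> {0..1}"
  shows "arc_rooted_density D W a x y = p ^ card (arcs D)"
proof -
  interpret D: oriented_graph D by (rule D)
  let ?I = "verts D - {tail D a, head D a}"
  interpret C: prob_space "unit_cube_measure ?I" by (rule prob_space_unit_cube)
  have "arc_rooted_density D W a x y = (LINT z|unit_cube_measure ?I. p ^ card (arcs D))"
    unfolding arc_rooted_density_def
  proof (rule Bochner_Integration.integral_cong[OF refl])
    fix z assume "z \<in> space (unit_cube_measure ?I)"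
    then have z: "z v \<in> {0..1}" if "v \<in> ?I" for v
      using that by (auto simp: unit_cube_measure_eq space_PiM PiE_iff)
    show "arc_product D W (z(tail D a := x, head D a := y)) = p ^ card (arcs D)"
      by (rule D.eulerian_arc_product_potential[OF eul, where \<phi>=\<phi>]) (rule W; use z xy in auto)
  qed
  then show ?thesis by (simp add: C.prob_space)
qed

theorem theorem1p3:
  shows
    "(\<forall>(D :: ('v, 'e) pre_digraph) W.
        oriented_graph D \<and> card (arcs D) \<ge> 1 \<and> directed_kernel W \<and>
        (\<forall>a\<in>arcs D. \<exists>c. AE (x, y) in unit_square_measure. arc_rooted_density D W a x y = c) \<and>
        hom_density D W > 0 \<longrightarrow>
        (let p = root (card (arcs D)) (hom_density D W) in
           (\<not> eulerian D \<longrightarrow> (AE (x, y) in unit_square_measure. W x y = p)) \<and>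
           (eulerian D \<longrightarrow>
              p \<in> {0<..1} \<and>
              (\<exists>\<phi>. bounded_measurable \<phi> \<and>
                 (AE (x, y) in unit_square_measure. W x y = p * exp (\<phi> x - \<phi> y))))))
     \<and>
     (\<forall>W p \<phi>.
        directed_kernel W \<and> p \<in> {0<..1} \<and> bounded_measurable \<phi> \<and>
        (\<forall>x\<in>{0..1}. \<forall>y\<in>{0..1}. W x y = p * exp (\<phi> x - \<phi> y)) \<longrightarrow>
        (\<forall>D :: ('v, 'e) pre_digraph.
           oriented_graph D \<and> eulerian D \<and> card (arcs D) \<ge> 1 \<longrightarrow>
           (\<forall>a\<in>arcs D. AE (x, y) in unit_square_measure.
              arc_rooted_density D W a x y = p ^ card (arcs D))))"
proof (intro conjI allI impI)
  fix D :: "('v, 'e) pre_digraph" and W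
  assume A: "oriented_graph D \<and> card (arcs D) \<ge> 1 \<and> directed_kernel W \<and>
        (\<forall>a\<in>arcs D. \<exists>c. AE (x, y) in unit_square_measure. arc_rooted_density D W a x y = c) \<and>
        hom_density D W > 0"
  then have "arcs D \<noteq> {}" by auto
  from constant_rooted_densities_imp_potential[of D W] this A
  show "let p = root (card (arcs D)) (hom_density D W) in
           (\<not> eulerian D \<longrightarrow> (AE (x, y) in unit_square_measure. W x y = p)) \<and>
           (eulerian D \<longrightarrow>
              p \<in> {0<..1} \<and>
              (\<exists>\<phi>. bounded_measurable \<phi> \<and>
                 (AE (x, y) in unit_square_measure. W x y = p * exp (\<phi> x - \<phi> y))))"
    unfolding Let_def by blast
next
  fix W :: "real \<Rightarrow> real \<Rightarrow> real" and p :: real and \<phi> and D :: "('v, 'e) pre_digraph"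
  assume "directed_kernel W \<and> p \<in> {0<..1} \<and> bounded_measurable \<phi> \<and>
        (\<forall>x\<in>{0..1}. \<forall>y\<in>{0..1}. W x y = p * exp (\<phi> x - \<phi> y))"
    and "oriented_graph D \<and> eulerian D \<and> card (arcs D) \<ge> 1"
  then show "\<forall>a\<in>arcs D. AE (x, y) in unit_square_measure. arc_rooted_density D W a x y = p ^ card (arcs D)"
    by (intro ballI AE_I2) (auto intro!: eulerian_rooted_density_potential)
qed

end
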